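(* Let $\mathcal{T}_0=(A_0,B_0,C_0,D_0)$ be a quadruple of non-coplanar points of the unit sphere $\mathcal{S}\subset\mathbb{R}^3$ with center $O$, with squared edge lengths $(d_{ij})_{i<j}$, and let $(\mathcal{T}_n)_{n\ge0}$, with centroids $(G_n)_{n\ge 0}$, be the sequence of quadruples produced from it by the iteration described in the context. Then: i) The sequence $(OG_n)_n$ tends to $0$. ii) Let $\mathcal{T}=(A,B,C,D)$ be a cluster point of the bounded sequence $(\mathcal{T}_n)_n$ in $\mathcal{S}^4$. Then $\mathcal{T}$ is not flat (its vertices are not coplanar) and $\mathcal{T}$ is isometric to a fixed isosceles tetrahedron (independent of the cluster point), whose squared edge lengths $d_{12}^\infty=d_{34}^\infty$, $d_{13}^\infty=d_{24}^\infty$, $d_{14}^\infty=d_{23}^\infty$ are given by $$(d_{12}^\infty)^2=L\,d_{12}d_{34},\quad (d_{13}^\infty)^2=L\,d_{13}d_{24},\quad (d_{14}^\infty)^2=L\,d_{14}d_{23},$$ where $$L=\frac{64}{\left(\sqrt{d_{12}d_{34}}+\sqrt{d_{13}d_{24}}+\sqrt{d_{14}d_{23}}\right)^2}.$$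
   Context: $MN$ denotes the Euclidean distance. Iteration: given $\mathcal{T}_n=(A_n,B_n,C_n,D_n)\in\mathcal{S}^4$ (points not all equal) with centroid $G_n$, $\mathcal{T}_{n+1}=(A_{n+1},B_{n+1},C_{n+1},D_{n+1})$, where $A_{n+1}$ is the second intersection point of the line $G_nA_n$ with $\mathcal{S}$ (other than $A_n$), and similarly for $B_{n+1},C_{n+1},D_{n+1}$. Squared edge lengths of a quadruple $(A,B,C,D)$: $d_{12}=AB^2$, $d_{13}=AC^2$, $d_{14}=AD^2$, $d_{23}=BC^2$, $d_{24}=BD^2$, $d_{34}=CD^2$. A non-planar tetrahedron is isosceles if $d_{12}=d_{34}$, $d_{13}=d_{24}$, $d_{14}=d_{23}$. *)

theory Defs
  imports "HOL-Analysis.Analysis"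
begin

text \<open>A quadruple $(A,B,C,D)$ of points of $\mathbb{R}^3$ is a vector \<open>T :: real^3^4\<close> with
  vertices \<open>T $ 1\<close>, \<open>T $ 2\<close>, \<open>T $ 3\<close>, \<open>T $ 4\<close>; the unit sphere is \<open>sphere 0 1\<close>. In the
  index type \<open>4\<close> the numeral 4 equals 0, and 1, 2, 3, 4 are its four distinct elements.\<close>

type_synonym quadruple = "real^3^4"

definition vertices :: "quadruple \<Rightarrow> (real^3) set" where
  "vertices T = range (\<lambda>i. T $ i)"

definition centroid :: "quadruple \<Rightarrow> real^3" where
  "centroid T = (1/4) *\<^sub>R (\<Sum>i\<in>UNIV. T $ i)"

definition sqedge :: "quadruple \<Rightarrow> 4 \<Rightarrow> 4 \<Rightarrow> real" where
  "sqedge T i j = (dist (T $ i) (T $ j))\<^sup>2"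

text \<open>\<open>affine hull {G, A}\<close> is the line $GA$ when \<open>G \<noteq> A\<close>. The description below is
  unique whenever \<open>A\<close> is on the sphere and \<open>G\<close> is in the open ball; this covers
  centroids of quadruples of points of the sphere that are not all equal.\<close>

definition second_intersection :: "real^3 \<Rightarrow> real^3 \<Rightarrow> real^3" where
  "second_intersection G A = (THE X. X \<in> affine hull {G, A} \<inter> sphere 0 1 \<and> X \<noteq> A)"

lemma second_intersection_ex1:
  fixes A G :: "real^3"
  assumes A: "A \<in> sphere 0 1" and G: "G \<in> ball 0 1"
  shows "\<exists>!X. X \<in> affine hull {G, A} \<inter> sphere 0 1 \<and> X \<noteq> A"
proof -
  define v where "v = G - A"
  have nA: "A \<bullet> A = 1"
    using A by (simp add: dot_square_norm)
  have "A \<bullet> G \<le> norm A * norm G"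
    by (rule norm_cauchy_schwarz)
  then have Av: "A \<bullet> v < 0"
    using A G nA by (simp add: v_def inner_diff_right)
  then have v: "v \<bullet> v > 0"
    by auto
  have line: "affine hull {G, A} = range (\<lambda>t. A + t *\<^sub>R v)"
    unfolding v_def insert_commute[of G A "{}"] affine_hull_2_alt by auto
  have eq: "(A + t *\<^sub>R v) \<bullet> (A + t *\<^sub>R v) = 1 + t * (2 * (A \<bullet> v) + t * (v \<bullet> v))" for t
    using nA by (simp add: inner_add_left inner_add_right inner_commute algebra_simps)
  have on: "A + t *\<^sub>R v \<in> sphere 0 1 \<longleftrightarrow> t = 0 \<or> 2 * (A \<bullet> v) + t * (v \<bullet> v) = 0" for t
    using eq[of t] by (simp add: norm_eq_1)
  define s where "s = - 2 * (A \<bullet> v) / (v \<bullet> v)"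
  have s: "2 * (A \<bullet> v) + t * (v \<bullet> v) = 0 \<longleftrightarrow> t = s" for t
    using v by (auto simp: s_def field_simps)
  have "s \<noteq> 0"
    using v Av by (simp add: s_def)
  show ?thesis
  proof (rule ex1I[of _ "A + s *\<^sub>R v"])
    show "A + s *\<^sub>R v \<in> affine hull {G, A} \<inter> sphere 0 1 \<and> A + s *\<^sub>R v \<noteq> A"
      using on[of s] s[of s] \<open>s \<noteq> 0\<close> v unfolding line by auto
  next
    fix X assume X: "X \<in> affine hull {G, A} \<inter> sphere 0 1 \<and> X \<noteq> A"
    then obtain t where t: "X = A + t *\<^sub>R v"
      unfolding line by auto
    then have "t \<noteq> 0" "A + t *\<^sub>R v \<in> sphere 0 1"
      using X by auto
    then show "X = A + s *\<^sub>R v"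
      using on[of t] s[of t] t by simp
  qed
qed

definition next_quadruple :: "quadruple \<Rightarrow> quadruple" where
  "next_quadruple T = (\<chi> i. second_intersection (centroid T) (T $ i))"

definition isosceles :: "quadruple \<Rightarrow> bool" where
  "isosceles T \<longleftrightarrow> \<not> coplanar (vertices T) \<and>
     sqedge T 1 2 = sqedge T 3 4 \<and> sqedge T 1 3 = sqedge T 2 4 \<and> sqedge T 1 4 = sqedge T 2 3"

text \<open>Isometries of the whole space, orientation reversing ones included, that respect the
  labelling of the vertices.\<close>

definition isometric :: "quadruple \<Rightarrow> quadruple \<Rightarrow> bool" where
  "isometric S T \<longleftrightarrow>
     (\<exists>f :: real^3 \<Rightarrow> real^3. (\<forall>x y. dist (f x) (f y) = dist x y) \<and> (\<forall>i. f (S $ i) = T $ i))"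

definition cluster_point :: "(nat \<Rightarrow> 'a::topological_space) \<Rightarrow> 'a \<Rightarrow> bool" where
  "cluster_point X x \<longleftrightarrow> (\<forall>U. open U \<and> x \<in> U \<longrightarrow> (\<exists>\<^sub>F n in sequentially. X n \<in> U))"

end

theory Submission
  imports Defs
begin

text \<open>
By the power of a point, one step of the iteration is the inversion of negative power
\<open>- p\<close> about the centroid \<open>G\<close>, where \<open>p = 1 - (norm G)\<^sup>2\<close> (\<open>second_intersection_eq\<close>). With \<open>r\<^sub>i\<close> the
squared distance from \<open>G\<close> to the \<open>i\<close>-th vertex, it multiplies the squared edge \<open>d\<^sub>i\<^sub>j\<close> by
\<open>p\<^sup>2 / (r\<^sub>i r\<^sub>j)\<close>. All three products of opposite squared edges are thus multiplied by the same factor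
\<open>p\<^sup>4 / (r\<^sub>1 r\<^sub>2 r\<^sub>3 r\<^sub>4)\<close> (\<open>opposite_products_next_quadruple\<close>). Because \<open>G\<close> is the centroid, \<open>p\<close> is the
arithmetic mean of the \<open>r\<^sub>i\<close>, so by the mean inequality the factor is at least \<open>1\<close>. The products
are bounded on the sphere; hence the product of all factors converges, and the factors tend to \<open>1\<close>.

At a cluster point the mean inequality is therefore an equality and all vertices are equidistant
from \<open>G\<close>. Either \<open>G\<close> is the centre of the sphere or the vertices lie in the plane through \<open>G\<close>
orthogonal to \<open>G\<close>. The second case is excluded by an invariant: for points of the unit
sphere, the defect in Ptolemy's inequality, a quadratic form in the three products of opposite
squared edges, equals \<open>16\<close> times the squared triple product of three edge vectors
(\<open>ptolemy_eq_triple_product\<close>). It starts positive and is never decreased, so no cluster point is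
coplanar. Compactness turns the vanishing of \<open>G\<close> at all cluster points into convergence
of the centroids to the centre.

If the centroid is the centre, opposite edges are equal and the squared lengths of the three edges at a
vertex add up to \<open>8\<close> (\<open>balanced_edges\<close>). Since the ratios of the products are invariant, this determines
all edges of a cluster point, and tetrahedra with equal edges are isometric. Any cluster
point serves as the isosceles model tetrahedron.
\<close>

unbundle cross3_syntax

section \<open>Coplanarity on the sphere and the Ptolemy form\<close>

lemma coplanar_iff_in_hyperplane:
  fixes S :: "(real^3) set"
  shows "coplanar S \<longleftrightarrow> (\<exists>a b. a \<noteq> 0 \<and> S \<subseteq> {x. a \<bullet> x = b})"
proof
  assume "coplanar S"
  then obtain u v w where S: "S \<subseteq> affine hull {u, v, w}"
    unfolding coplanar_def by blast
  have "card {u, v, w} \<le> 3"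
    by (simp add: card_insert_if)
  moreover have "aff_dim {u, v, w} \<le> int (card {u, v, w}) - 1"
    by (rule aff_dim_le_card) simp
  ultimately have "aff_dim (affine hull {u, v, w}) < int DIM(real^3)"
    by simp
  then show "\<exists>a b. a \<noteq> 0 \<and> S \<subseteq> {x. a \<bullet> x = b}"
    by (rule aff_lowdim_subset_hyperplane) (use S in blast)
next
  assume "\<exists>a b. a \<noteq> 0 \<and> S \<subseteq> {x. a \<bullet> x = b}"
  then obtain a b where a: "a \<noteq> 0" and S: "S \<subseteq> {x. a \<bullet> x = b}"
    by blast
  obtain B where B: "\<not> affine_dependent B" "affine hull {x. a \<bullet> x = b} = affine hull B"
    using affine_basis_exists by metis
  have "aff_dim B = aff_dim (affine hull {x. a \<bullet> x = b})"
    by (simp only: B(2) aff_dim_affine_hull)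
  also have "\<dots> = 2"
    using a by simp
  finally have "aff_dim B = 2" .
  then have "card B = 3"
    using aff_dim_affine_independent[OF B(1)] by simp
  then obtain u v w where "B = {u, v, w}"
    by (auto simp: card_3_iff)
  then show "coplanar S"
    using S B(2) hull_subset[of "{x. a \<bullet> x = b}" affine] unfolding coplanar_def by blast
qed

definition triple_product :: "quadruple \<Rightarrow> real" where
  "triple_product T = (T $ 2 - T $ 1) \<bullet> ((T $ 3 - T $ 1) \<times> (T $ 4 - T $ 1))"

text \<open>The vectors \<open>v \<times> w\<close>, \<open>w \<times> u\<close>, \<open>u \<times> v\<close> are, up to the factor \<open>u \<bullet> (v \<times> w)\<close>, the
basis dual to \<open>u\<close>, \<open>v\<close>, \<open>w\<close>. The identity serves twice: a normal vector of a plane through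
four points makes the right-hand side vanish, and for a vertex \<open>x\<close> on the sphere it
expresses the volume through squared edge lengths alone.\<close>

lemma triple_product_expansion:
  fixes u v w x :: "real^3"
  shows "(u \<bullet> (v \<times> w)) *\<^sub>R x =
    (x \<bullet> u) *\<^sub>R (v \<times> w) + (x \<bullet> v) *\<^sub>R (w \<times> u) + (x \<bullet> w) *\<^sub>R (u \<times> v)"
  by (simp add: cross3_simps forall_3)

lemma coplanar_iff_triple_product:
  "coplanar (vertices T) \<longleftrightarrow> triple_product T = 0"
proof
  assume "coplanar (vertices T)"
  then obtain a b where a: "a \<noteq> 0" and b: "\<And>i. a \<bullet> T $ i = b"
    unfolding coplanar_iff_in_hyperplane vertices_def by (auto simp: image_subset_iff)
  \<comment> \<open>Every edge vector is orthogonal to the normal \<open>a\<close> of the plane.\<close>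
  have "triple_product T *\<^sub>R a = 0"
    unfolding triple_product_def triple_product_expansion[of _ _ _ a]
    by (simp add: inner_diff_right b)
  then show "triple_product T = 0"
    using a by simp
next
  let ?A = "vector [T $ 2 - T $ 1, T $ 3 - T $ 1, T $ 4 - T $ 1] :: real^3^3"
  assume "triple_product T = 0"
  then have "det ?A = 0"
    by (simp add: triple_product_def dot_cross_det)
  then obtain a where a: "a \<noteq> 0" "?A *v a = 0"
    using matrix_nonfull_linear_equations_eq[of ?A] det_eq_0_rank[of ?A] by auto
  then have "(T $ i - T $ 1) \<bullet> a = 0" for i
    using exhaust_4[of i] by (auto simp: vec_eq_iff forall_3 matrix_vector_mul_component)
  then have "a \<bullet> T $ i = a \<bullet> T $ 1" for i
    by (simp add: inner_diff_left inner_commute[of a])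
  then show "coplanar (vertices T)"
    using a(1) unfolding coplanar_iff_in_hyperplane vertices_def
    by (intro exI[of _ a] exI[of _ "a \<bullet> T $ 1"]) auto
qed

text \<open>With \<open>x = p\<^sup>2\<close>, \<open>y = q\<^sup>2\<close>, \<open>z = r\<^sup>2\<close> the form is Heron's product
\<open>(p + q + r) (- p + q + r) (p - q + r) (p + q - r)\<close>. When \<open>p\<close>, \<open>q\<close>, \<open>r\<close> are the products of
opposite edge lengths, its vanishing is the equality case of Ptolemy's inequality.\<close>

definition ptolemy_form :: "real \<times> real \<times> real \<Rightarrow> real" where
  "ptolemy_form = (\<lambda>(x, y, z). 2 * (x * y + y * z + z * x) - x\<^sup>2 - y\<^sup>2 - z\<^sup>2)"

definition opposite_products :: "quadruple \<Rightarrow> real \<times> real \<times> real" where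
  "opposite_products T = (sqedge T 1 2 * sqedge T 3 4,
     sqedge T 1 3 * sqedge T 2 4, sqedge T 1 4 * sqedge T 2 3)"

definition on_sphere :: "quadruple \<Rightarrow> bool" where
  "on_sphere T \<longleftrightarrow> (\<forall>i. T $ i \<in> sphere 0 1)"

text \<open>Ptolemy's inequality with its defect. For \<open>a = T $ 1\<close> on the sphere and an edge vector \<open>u\<close>
from \<open>a\<close> to another point of the sphere, \<open>a \<bullet> u = - (u \<bullet> u) / 2\<close>. Expanding \<open>a\<close> in the dual basis
and taking the squared length therefore writes the squared volume as a polynomial in the
squared edges, and this polynomial is the Ptolemy form.\<close>

lemma ptolemy_eq_triple_product:
  assumes "on_sphere T"
  shows "ptolemy_form (opposite_products T) = 16 * (triple_product T)\<^sup>2"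
proof -
  define a u v w where "a = T $ 1" and "u = T $ 2 - T $ 1" and "v = T $ 3 - T $ 1"
    and "w = T $ 4 - T $ 1"
  have unit: "T $ i \<bullet> T $ i = 1" for i
    using assms by (simp add: on_sphere_def norm_eq_1)
  have aa: "a \<bullet> a = 1"
    and au: "a \<bullet> u = - (u \<bullet> u) / 2" and av: "a \<bullet> v = - (v \<bullet> v) / 2"
    and aw: "a \<bullet> w = - (w \<bullet> w) / 2"
    by (simp_all add: a_def u_def v_def w_def unit inner_diff_left inner_diff_right inner_commute)
  have edges: "sqedge T 1 2 = u \<bullet> u" "sqedge T 1 3 = v \<bullet> v" "sqedge T 1 4 = w \<bullet> w"
    "sqedge T 2 3 = u \<bullet> u + v \<bullet> v - 2 * (u \<bullet> v)"
    "sqedge T 2 4 = u \<bullet> u + w \<bullet> w - 2 * (u \<bullet> w)"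
    "sqedge T 3 4 = v \<bullet> v + w \<bullet> w - 2 * (v \<bullet> w)"
    by (simp_all add: sqedge_def dist_norm power2_norm_eq_inner u_def v_def w_def
        inner_diff_left inner_diff_right inner_commute)
  have "(triple_product T)\<^sup>2 = (triple_product T *\<^sub>R a) \<bullet> (triple_product T *\<^sub>R a)"
    by (simp add: aa power2_eq_square)
  also have "triple_product T *\<^sub>R a = - (1/2) *\<^sub>R ((u \<bullet> u) *\<^sub>R (v \<times> w)
      + (v \<bullet> v) *\<^sub>R (w \<times> u) + (w \<bullet> w) *\<^sub>R (u \<times> v))"
    unfolding triple_product_def u_def[symmetric] v_def[symmetric] w_def[symmetric]
      triple_product_expansion[of u v w a] au av aw
    by (simp add: scaleR_add_right)
  finally have "(triple_product T)\<^sup>2 = (1/4) * (((u \<bullet> u) *\<^sub>R (v \<times> w)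
      + (v \<bullet> v) *\<^sub>R (w \<times> u) + (w \<bullet> w) *\<^sub>R (u \<times> v)) \<bullet> ((u \<bullet> u) *\<^sub>R (v \<times> w)
      + (v \<bullet> v) *\<^sub>R (w \<times> u) + (w \<bullet> w) *\<^sub>R (u \<times> v)))"
    by simp
  then have "16 * (triple_product T)\<^sup>2 = ptolemy_form (opposite_products T)"
    unfolding ptolemy_form_def opposite_products_def prod.case edges inner_add_left inner_add_right
      inner_scaleR_left inner_scaleR_right dot_cross inner_commute[of v u]
      inner_commute[of w u] inner_commute[of w v]
    by algebra
  then show ?thesis
    by simp
qed

section \<open>One step is an inversion centred at the centroid\<close>

text \<open>The power of the centroid with respect to the sphere, with the sign that makes it positive
inside the ball.\<close>

definition power_centroid :: "quadruple \<Rightarrow> real" where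
  "power_centroid T = 1 - (norm (centroid T))\<^sup>2"

definition centroid_sqdist :: "quadruple \<Rightarrow> 4 \<Rightarrow> real" where
  "centroid_sqdist T i = (dist (T $ i) (centroid T))\<^sup>2"

lemma centroid_sqdist_eq:
  assumes "on_sphere T"
  shows "centroid_sqdist T i = 1 - 2 * (T $ i \<bullet> centroid T) + (norm (centroid T))\<^sup>2"
proof -
  have "T $ i \<bullet> T $ i = 1"
    using assms by (simp add: on_sphere_def norm_eq_1)
  then show ?thesis
    by (simp add: centroid_sqdist_def dist_norm power2_norm_eq_inner inner_diff_left
        inner_diff_right inner_commute)
qed

lemma sum_vertices: "T $ 1 + T $ 2 + T $ 3 + T $ 4 = 4 *\<^sub>R centroid T"
  by (simp add: centroid_def sum_4)

text \<open>Leibniz's relation: the power of the centroid is the arithmetic mean of its squared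
distances to the four vertices. This is where it matters that the inversion is centred at
the centroid.\<close>

lemma sum_centroid_sqdist:
  assumes "on_sphere T"
  shows "centroid_sqdist T 1 + centroid_sqdist T 2 + centroid_sqdist T 3 + centroid_sqdist T 4
    = 4 * power_centroid T"
proof -
  have "T $ 1 \<bullet> centroid T + T $ 2 \<bullet> centroid T + T $ 3 \<bullet> centroid T + T $ 4 \<bullet> centroid T
      = 4 * (norm (centroid T))\<^sup>2"
    by (simp add: inner_add_left[symmetric] sum_vertices power2_norm_eq_inner)
  then show ?thesis
    by (simp add: centroid_sqdist_eq[OF assms] power_centroid_def)
qed

text \<open>If the centroid were not inside the ball, its power, and hence by Leibniz's relation the sum
of the squared distances from it to the vertices, would not be positive, so all vertices
would coincide.\<close>

lemma centroid_in_ball: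
  assumes "on_sphere T" and "T $ i \<noteq> T $ j"
  shows "norm (centroid T) < 1"
proof (rule ccontr)
  assume "\<not> norm (centroid T) < 1"
  then have "power_centroid T \<le> 0"
    by (simp add: power_centroid_def one_le_power)
  moreover have "centroid_sqdist T k \<ge> 0" for k
    by (simp add: centroid_sqdist_def)
  ultimately have "\<forall>k. centroid_sqdist T k = 0"
    using sum_centroid_sqdist[OF assms(1)] unfolding forall_4 by (smt (verit))
  then show False
    using assms(2) by (simp add: centroid_sqdist_def)
qed

text \<open>By the power of a point, the product of the distances from \<open>G\<close> to the two intersection
points is \<open>1 - (norm G)\<^sup>2\<close>, and these points lie on opposite sides of \<open>G\<close>. So the map is the
inversion with centre \<open>G\<close> and negative power.\<close>

lemma second_intersection_eq:
  fixes A G :: "real^3"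
  assumes A: "A \<in> sphere 0 1" and G: "norm G < 1"
  shows "second_intersection G A = G - ((1 - (norm G)\<^sup>2) / (dist A G)\<^sup>2) *\<^sub>R (A - G)"
proof -
  define r where "r = (dist A G)\<^sup>2"
  define p where "p = 1 - (norm G)\<^sup>2"
  define X where "X = G - (p / r) *\<^sub>R (A - G)"
  have "A \<noteq> G"
    using A G by auto
  then have r: "r > 0"
    by (simp add: r_def)
  have p: "p > 0"
    using G by (simp add: p_def abs_square_less_1)
  have AA: "A \<bullet> A = 1"
    using A by (simp add: norm_eq_1)
  have rr: "(A - G) \<bullet> (A - G) = r"
    by (simp add: r_def dist_norm power2_norm_eq_inner)
  have GA: "2 * (G \<bullet> (A - G)) = p - r"
    using rr AA by (simp add: p_def power2_norm_eq_inner inner_diff_left inner_diff_right inner_commute)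
  have GG: "G \<bullet> G = 1 - p"
    by (simp add: p_def power2_norm_eq_inner)
  have "(G - c *\<^sub>R w) \<bullet> (G - c *\<^sub>R w) = G \<bullet> G - c * (2 * (G \<bullet> w)) + c\<^sup>2 * (w \<bullet> w)" for c w
    by (simp add: inner_diff_left inner_diff_right inner_commute[of w G] power2_eq_square
        algebra_simps)
  then have "X \<bullet> X = G \<bullet> G - (p / r) * (2 * (G \<bullet> (A - G))) + (p / r)\<^sup>2 * ((A - G) \<bullet> (A - G))"
    unfolding X_def .
  also have "\<dots> = 1"
    unfolding GA rr GG using r by (simp add: field_simps power2_eq_square)
  finally have on: "X \<in> sphere 0 1"
    by (simp add: norm_eq_1)
  have "X = (1 + p / r) *\<^sub>R G + (- (p / r)) *\<^sub>R A"
    by (simp add: X_def algebra_simps)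
  then have "X \<in> affine hull {G, A}"
    unfolding affine_hull_2 by (smt (verit) mem_Collect_eq)
  moreover have "X - A = - (1 + p / r) *\<^sub>R (A - G)"
    by (simp add: X_def algebra_simps)
  moreover have "1 + p / r > 0"
    using r p by (simp add: add_pos_pos)
  ultimately have "X - A \<noteq> 0"
    using \<open>A \<noteq> G\<close> by auto
  with on \<open>X \<in> affine hull {G, A}\<close> have "second_intersection G A = X"
    unfolding second_intersection_def
    using second_intersection_ex1[OF A, of G] G by (intro the1_equality) auto
  then show ?thesis
    by (simp add: X_def p_def r_def)
qed

lemma centroid_sqdist_pos:
  assumes "on_sphere T" and "norm (centroid T) < 1"
  shows "centroid_sqdist T i > 0"
proof -
  have "norm (T $ i) = 1"
    using assms(1) by (simp add: on_sphere_def)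
  then show ?thesis
    using assms(2) by (auto simp: centroid_sqdist_def)
qed

lemma on_sphere_next_quadruple:
  assumes "on_sphere T" and "norm (centroid T) < 1"
  shows "on_sphere (next_quadruple T)"
  unfolding on_sphere_def next_quadruple_def
  using assms theI'[OF second_intersection_ex1, of _ "centroid T"]
  by (auto simp: on_sphere_def second_intersection_def)

lemma inversion_sqdist:
  fixes u v :: "'a::real_inner"
  assumes "u \<noteq> 0" and "v \<noteq> 0"
  shows "(dist ((p / (norm u)\<^sup>2) *\<^sub>R u) ((p / (norm v)\<^sup>2) *\<^sub>R v))\<^sup>2
    = p\<^sup>2 * (dist u v)\<^sup>2 / ((norm u)\<^sup>2 * (norm v)\<^sup>2)"
proof -
  have "u \<bullet> u \<noteq> 0" "v \<bullet> v \<noteq> 0"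
    using assms by auto
  then show ?thesis
    unfolding dist_norm power2_norm_eq_inner
    by (simp add: inner_diff_left inner_diff_right inner_commute[of v u] field_simps power2_eq_square)
qed

lemma sqedge_next_quadruple:
  assumes T: "on_sphere T" and G: "norm (centroid T) < 1"
  shows "sqedge (next_quadruple T) i j
    = (power_centroid T)\<^sup>2 * sqedge T i j / (centroid_sqdist T i * centroid_sqdist T j)"
proof -
  let ?G = "centroid T" and ?p = "power_centroid T"
  have ne: "T $ k - ?G \<noteq> 0" for k
    using centroid_sqdist_pos[OF assms, of k] by (auto simp: centroid_sqdist_def)
  have next_eq: "next_quadruple T $ k
      = ?G - (?p / (norm (T $ k - ?G))\<^sup>2) *\<^sub>R (T $ k - ?G)" for k
    using T G by (simp add: next_quadruple_def second_intersection_eq on_sphere_def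
        power_centroid_def dist_norm)
  have "dist (?G - x) (?G - y) = dist x y" for x y
    by (simp add: dist_norm norm_minus_commute)
  then have "sqedge (next_quadruple T) i j = (dist ((?p / (norm (T $ i - ?G))\<^sup>2) *\<^sub>R (T $ i - ?G))
      ((?p / (norm (T $ j - ?G))\<^sup>2) *\<^sub>R (T $ j - ?G)))\<^sup>2"
    by (simp add: sqedge_def next_eq)
  also have "\<dots> = ?p\<^sup>2 * (dist (T $ i - ?G) (T $ j - ?G))\<^sup>2
      / ((norm (T $ i - ?G))\<^sup>2 * (norm (T $ j - ?G))\<^sup>2)"
    by (rule inversion_sqdist[OF ne ne])
  finally show ?thesis
    by (simp add: sqedge_def centroid_sqdist_def dist_norm)
qed

section \<open>The mean inequality for four numbers\<close>

text \<open>The two-variable inequality, applied to \<open>a\<close>, \<open>b\<close>, to \<open>c\<close>, \<open>d\<close> and then to the two half sums.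
For \<open>m > 0\<close>, equality of the means forces equality at each of the three stages, so that all
numbers agree.\<close>

lemma arith_geo_mean_4:
  fixes a b c d m :: real
  assumes nonneg: "a \<ge> 0" "b \<ge> 0" "c \<ge> 0" "d \<ge> 0" and sum: "a + b + c + d = 4 * m"
  shows "a * b * c * d \<le> m ^ 4"
    and "m > 0 \<Longrightarrow> a * b * c * d = m ^ 4 \<Longrightarrow> a = m \<and> b = m \<and> c = m \<and> d = m"
proof -
  define s t where "s = (a + b) / 2" and "t = (c + d) / 2"
  have ab: "a * b = s\<^sup>2 - ((a - b) / 2)\<^sup>2" and cd: "c * d = t\<^sup>2 - ((c - d) / 2)\<^sup>2"
    by (simp_all add: s_def t_def power2_eq_square field_simps)
  have m: "m = (s + t) / 2"
    using sum by (simp add: s_def t_def field_simps)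
  have st: "s * t = m\<^sup>2 - ((s - t) / 2)\<^sup>2"
    unfolding m by (simp add: power2_eq_square field_simps)
  have s0: "s \<ge> 0" and t0: "t \<ge> 0"
    using nonneg by (simp_all add: s_def t_def)
  have 1: "a * b \<le> s\<^sup>2" and 2: "c * d \<le> t\<^sup>2" and 3: "s * t \<le> m\<^sup>2"
    by (simp_all add: ab cd st)
  have 4: "(a * b) * (c * d) \<le> s\<^sup>2 * t\<^sup>2"
    using 1 2 nonneg by (intro mult_mono) auto
  have 5: "(s * t)\<^sup>2 \<le> (m\<^sup>2)\<^sup>2"
    using 3 s0 t0 by (intro power_mono) auto
  have pow: "(m\<^sup>2)\<^sup>2 = m ^ 4"
    by (simp flip: power_mult)
  show "a * b * c * d \<le> m ^ 4"
    using 4 5 pow by (simp add: power_mult_distrib mult.assoc)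
  assume "m > 0" and eq: "a * b * c * d = m ^ 4"
  then have eq4: "(a * b) * (c * d) = s\<^sup>2 * t\<^sup>2" and "(s * t)\<^sup>2 = (m\<^sup>2)\<^sup>2"
    using 4 5 pow by (simp_all add: power_mult_distrib mult.assoc)
  then have "s * t = m\<^sup>2"
    using s0 t0 power2_eq_imp_eq[of "s * t" "m\<^sup>2"] by simp
  then have "s = t" "s > 0"
    using st m \<open>m > 0\<close> by auto
  have "a * b = s\<^sup>2"
  proof (rule ccontr)
    assume "a * b \<noteq> s\<^sup>2"
    then have "a * b < s\<^sup>2"
      using 1 by simp
    then have "(a * b) * t\<^sup>2 < s\<^sup>2 * t\<^sup>2"
      using \<open>s > 0\<close> \<open>s = t\<close> by (intro mult_strict_right_mono) auto
    moreover have "(a * b) * (c * d) \<le> (a * b) * t\<^sup>2"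
      using 2 nonneg by (intro mult_left_mono) auto
    ultimately have "(a * b) * (c * d) < s\<^sup>2 * t\<^sup>2"
      by linarith
    then show False
      using eq4 by simp
  qed
  moreover from this have "c * d = t\<^sup>2"
    using eq4 \<open>s > 0\<close> by simp
  ultimately have "a = b" "c = d"
    using ab cd by auto
  then show "a = m \<and> b = m \<and> c = m \<and> d = m"
    using \<open>s = t\<close> m by (simp add: s_def t_def)
qed

section \<open>Cluster points\<close>

lemma cluster_point_limit:
  fixes \<phi> :: "'a::topological_space \<Rightarrow> 'b::t2_space"
  assumes X: "cluster_point f X" and cont: "continuous_on UNIV \<phi>"
    and lim: "(\<lambda>n. \<phi> (f n)) \<longlonglongrightarrow> c"
  shows "\<phi> X = c"
proof (rule ccontr)
  assume "\<phi> X \<noteq> c"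
  then obtain U V where UV: "open U" "open V" "\<phi> X \<in> U" "c \<in> V" "U \<inter> V = {}"
    using hausdorff by metis
  have "open (\<phi> -` U)"
    using cont \<open>open U\<close> by (simp add: open_vimage)
  then have "\<exists>\<^sub>F n in sequentially. f n \<in> \<phi> -` U"
    using X UV(3) unfolding cluster_point_def by blast
  moreover have "\<forall>\<^sub>F n in sequentially. \<phi> (f n) \<in> V"
    using lim UV(2,4) by (simp add: topological_tendstoD)
  ultimately have "\<exists>\<^sub>F n in sequentially. f n \<in> \<phi> -` U \<and> \<phi> (f n) \<in> V"
    by (rule frequently_rev_mp[OF _ eventually_mono]) simp
  then show False
    using UV(5) by (auto dest: frequently_ex)
qed

lemma compact_imp_cluster_point_of_subsequence:
  fixes f :: "nat \<Rightarrow> 'a::metric_space" and r :: "nat \<Rightarrow> nat"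
  assumes K: "compact K" "\<And>n. f n \<in> K" and r: "strict_mono r"
  obtains X s where "cluster_point f X" "strict_mono s" "(\<lambda>n. f (r (s n))) \<longlonglongrightarrow> X"
proof -
  obtain X and s :: "nat \<Rightarrow> nat" where s: "strict_mono s" and X: "((f \<circ> r) \<circ> s) \<longlonglongrightarrow> X"
    using K unfolding compact_def by (metis comp_apply)
  have "cluster_point f X"
    unfolding cluster_point_def
  proof (intro allI impI)
    fix U assume "open U \<and> X \<in> U"
    then have "\<forall>\<^sub>F n in sequentially. f (r (s n)) \<in> U"
      using topological_tendstoD[OF X] by simp
    moreover have "n \<le> r (s n)" for n
      using seq_suble[OF strict_mono_compose[OF r s], of n] by simp
    ultimately show "\<exists>\<^sub>F n in sequentially. f n \<in> U"
      unfolding frequently_sequentially eventually_sequentially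
      by (meson linorder_linear order_trans)
  qed
  then show thesis
    using that s X by (simp add: o_def)
qed

text \<open>Otherwise some subsequence stays outside a neighbourhood of \<open>c\<close> under \<open>\<phi>\<close>; by compactness it has
a limit point, which is a cluster point of \<open>f\<close> and violates the assumption.\<close>

lemma tendsto_if_cluster_points:
  fixes f :: "nat \<Rightarrow> 'a::metric_space" and \<phi> :: "'a \<Rightarrow> 'b::topological_space"
  assumes K: "compact K" "\<And>n. f n \<in> K" and cont: "continuous_on UNIV \<phi>"
    and cluster: "\<And>X. cluster_point f X \<Longrightarrow> \<phi> X = c"
  shows "(\<lambda>n. \<phi> (f n)) \<longlonglongrightarrow> c"
proof (rule topological_tendstoI, rule ccontr)
  fix U assume U: "open U" "c \<in> U" and "\<not> (\<forall>\<^sub>F n in sequentially. \<phi> (f n) \<in> U)"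
  then obtain r :: "nat \<Rightarrow> nat" where r: "strict_mono r" "\<And>n. \<phi> (f (r n)) \<notin> U"
    using not_eventually_sequentiallyD by blast
  obtain X s where X: "cluster_point f X" and lim: "(\<lambda>n. f (r (s n))) \<longlonglongrightarrow> X"
    by (rule compact_imp_cluster_point_of_subsequence[OF K r(1)])
  have "isCont \<phi> X"
    using cont by (simp add: continuous_on_eq_continuous_at)
  then have "(\<lambda>n. \<phi> (f (r (s n)))) \<longlonglongrightarrow> c"
    using isCont_tendsto_compose[OF _ lim] cluster[OF X] by metis
  then have "\<forall>\<^sub>F n in sequentially. \<phi> (f (r (s n))) \<in> U"
    using U by (simp add: topological_tendstoD)
  then show False
    using r(2) by (simp add: eventually_sequentially)
qed

section \<open>Isometries of tetrahedra\<close>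

lemma norm_sum_cong_gram:
  fixes S X :: quadruple
  assumes "\<And>i j. S $ i \<bullet> S $ j = X $ i \<bullet> X $ j"
  shows "norm (\<Sum>i\<in>UNIV. c i *\<^sub>R S $ i) = norm (\<Sum>i\<in>UNIV. c i *\<^sub>R X $ i)"
  by (simp add: norm_eq_sqrt_inner inner_sum_left inner_sum_right assms)

lemma noncoplanar_vertices_span:
  assumes "\<not> coplanar (vertices S)"
  shows "\<exists>c :: 4 \<Rightarrow> real. x = (\<Sum>i\<in>UNIV. c i *\<^sub>R S $ i)"
proof -
  let ?h = "\<lambda>c :: real^4. \<Sum>i\<in>UNIV. c $ i *\<^sub>R S $ i"
  have "linear ?h"
    by (rule linearI) (simp_all add: scaleR_add_left sum.distrib scaleR_sum_right)
  then have sub: "subspace (range ?h)"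
    by (rule linear_subspace_image) (rule subspace_UNIV)
  have "?h (axis j 1) = S $ j" for j
  proof -
    have "axis j 1 $ i *\<^sub>R S $ i = (if i = j then S $ i else 0)" for i
      by (simp add: axis_def)
    then show ?thesis
      by simp
  qed
  then have "S $ j \<in> range ?h" for j
    using rangeI[of ?h "axis j 1"] by (simp only:)
  then have "vertices S \<subseteq> range ?h"
    unfolding vertices_def by (rule image_subsetI)
  then have "span (vertices S) \<subseteq> range ?h"
    using sub by (rule span_minimal)
  moreover have "span (vertices S) = UNIV"
  proof (rule ccontr)
    assume "span (vertices S) \<noteq> UNIV"
    then obtain a where "a \<noteq> 0" "span (vertices S) \<subseteq> {x. a \<bullet> x = 0}"
      using span_not_univ_subset_hyperplane by blast
    then show False
      using assms span_superset[of "vertices S"] unfolding coplanar_iff_in_hyperplane by blast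
  qed
  ultimately show ?thesis
    by blast
qed

text \<open>Write each point as a combination of the vertices of \<open>S\<close>, in any way, and transfer the chosen
coefficients to the vertices of \<open>X\<close>. Since lengths of combinations are determined by the Gram
matrix, the result preserves distances and sends vertex to vertex; in particular it does not
depend on the choice, so that linearity need not be established first.\<close>

lemma isometric_if_gram_eq:
  assumes S: "\<not> coplanar (vertices S)" and gram: "\<And>i j. S $ i \<bullet> S $ j = X $ i \<bullet> X $ j"
  shows "isometric S X"
proof -
  obtain c :: "real^3 \<Rightarrow> 4 \<Rightarrow> real" where c: "\<And>x. x = (\<Sum>i\<in>UNIV. c x i *\<^sub>R S $ i)"
    using noncoplanar_vertices_span[OF S] by metis
  define f where "f x = (\<Sum>i\<in>UNIV. c x i *\<^sub>R X $ i)" for x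
  have "dist (f x) (f y) = dist x y" for x y
  proof -
    have "dist (f x) (f y) = norm (\<Sum>i\<in>UNIV. (c x i - c y i) *\<^sub>R X $ i)"
      by (simp add: f_def dist_norm scaleR_diff_left sum_subtractf)
    also have "\<dots> = norm (\<Sum>i\<in>UNIV. (c x i - c y i) *\<^sub>R S $ i)"
      by (rule norm_sum_cong_gram[OF gram, symmetric])
    also have "\<dots> = dist x y"
      by (simp add: dist_norm scaleR_diff_left sum_subtractf flip: c)
    finally show ?thesis .
  qed
  moreover have "f (S $ j) = X $ j" for j
  proof -
    \<comment> \<open>The chosen coefficients of \<open>S $ j\<close> need not be those of the \<open>j\<close>-th unit vector,
      but the difference is a relation between the vertices of \<open>S\<close> and hence of \<open>X\<close>.\<close>
    let ?d = "\<lambda>i. c (S $ j) i - (if i = j then 1 else 0)"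
    have "(if i = j then 1 else 0) *\<^sub>R Y $ i = (if i = j then Y $ i else 0)" for i and Y :: quadruple
      by simp
    then have delta: "(\<Sum>i\<in>UNIV. ?d i *\<^sub>R Y $ i) = (\<Sum>i\<in>UNIV. c (S $ j) i *\<^sub>R Y $ i) - Y $ j"
      for Y :: quadruple
      by (simp add: scaleR_diff_left sum_subtractf)
    have "norm (\<Sum>i\<in>UNIV. ?d i *\<^sub>R X $ i) = norm (\<Sum>i\<in>UNIV. ?d i *\<^sub>R S $ i)"
      by (rule norm_sum_cong_gram[OF gram, symmetric])
    also have "\<dots> = 0"
      unfolding delta c[of "S $ j", symmetric] by simp
    finally show ?thesis
      unfolding delta by (simp add: f_def)
  qed
  ultimately show ?thesis
    unfolding isometric_def by blast
qed

section \<open>Tetrahedra whose centroid is the centre of the sphere\<close>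

lemma sqedge_on_sphere:
  assumes "on_sphere T"
  shows "sqedge T i j = 2 - 2 * (T $ i \<bullet> T $ j)"
proof -
  have "T $ k \<bullet> T $ k = 1" for k
    using assms by (simp add: on_sphere_def norm_eq_1)
  then show ?thesis
    by (simp add: sqedge_def dist_norm power2_norm_eq_inner inner_diff_left inner_diff_right
        inner_commute)
qed

text \<open>A vanishing centroid makes the sums of two opposite pairs of vertices negatives of each
other. These sums have the same length, which for unit vectors says that the inner products
of the two pairs agree. The total \<open>8\<close> later fixes the scale of the limit tetrahedron.\<close>

lemma balanced_edges:
  assumes T: "on_sphere T" and G: "centroid T = 0"
  shows "sqedge T 1 2 = sqedge T 3 4" "sqedge T 1 3 = sqedge T 2 4" "sqedge T 1 4 = sqedge T 2 3"
    and "sqedge T 1 2 + sqedge T 1 3 + sqedge T 1 4 = 8"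
proof -
  have unit: "T $ i \<bullet> T $ i = 1" for i
    using T by (simp add: on_sphere_def norm_eq_1)
  have sum: "T $ 1 + T $ 2 + T $ 3 + T $ 4 = 0"
    by (simp add: sum_vertices G)
  have opposite: "sqedge T i j = sqedge T k l"
    if "T $ i + T $ j = - (T $ k + T $ l)" for i j k l
  proof -
    have "(T $ i + T $ j) \<bullet> (T $ i + T $ j) = (T $ k + T $ l) \<bullet> (T $ k + T $ l)"
      by (simp only: that inner_minus_left inner_minus_right minus_minus)
    then show ?thesis
      by (simp add: sqedge_on_sphere[OF T] inner_add_left inner_add_right unit inner_commute)
  qed
  show "sqedge T 1 2 = sqedge T 3 4" "sqedge T 1 3 = sqedge T 2 4" "sqedge T 1 4 = sqedge T 2 3"
    using sum by (intro opposite; simp add: eq_neg_iff_add_eq_0 algebra_simps)+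
  have "T $ 1 \<bullet> (T $ 1 + T $ 2 + T $ 3 + T $ 4) = 0"
    by (simp add: sum)
  then show "sqedge T 1 2 + sqedge T 1 3 + sqedge T 1 4 = 8"
    by (simp add: sqedge_on_sphere[OF T] inner_add_right unit)
qed

section \<open>The effect of one step on the products of opposite edges\<close>

definition scale_factor :: "quadruple \<Rightarrow> real" where
  "scale_factor T = power_centroid T ^ 4 / (centroid_sqdist T 1 * centroid_sqdist T 2
     * centroid_sqdist T 3 * centroid_sqdist T 4)"

text \<open>Inversion divides each squared edge by the squared distances of its two end points from
the centre. A pair of opposite edges meets each vertex once, so the factor is the same for
all three pairs.\<close>

lemma opposite_products_next_quadruple:
  assumes "on_sphere T" and "norm (centroid T) < 1"
  shows "opposite_products (next_quadruple T) = scale_factor T *\<^sub>R opposite_products T"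
  by (simp add: opposite_products_def sqedge_next_quadruple[OF assms] scale_factor_def
      power2_eq_square power4_eq_xxxx mult_ac)

lemma scale_factor_ge_1:
  assumes "on_sphere T" and "norm (centroid T) < 1"
  shows "scale_factor T \<ge> 1"
  using arith_geo_mean_4(1)[OF _ _ _ _ sum_centroid_sqdist[OF assms(1)]] centroid_sqdist_pos[OF assms]
  by (simp add: scale_factor_def less_imp_le)

text \<open>Equality of the means makes the centroid equidistant from the vertices. A vertex \<open>a\<close> at squared
distance \<open>1 - (norm G)\<^sup>2\<close> from \<open>G\<close> satisfies \<open>G \<bullet> a = (norm G)\<^sup>2\<close>, which for \<open>G \<noteq> 0\<close> is the equation
of a plane.\<close>

lemma centroid_eq_0_if_amgm_equality:
  assumes T: "on_sphere T" and noncoplanar: "\<not> coplanar (vertices T)"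
    and eq: "centroid_sqdist T 1 * centroid_sqdist T 2 * centroid_sqdist T 3
      * centroid_sqdist T 4 = power_centroid T ^ 4"
    and G: "norm (centroid T) < 1"
  shows "centroid T = 0"
proof (rule ccontr)
  assume "centroid T \<noteq> 0"
  have "power_centroid T > 0"
    using G by (simp add: power_centroid_def abs_square_less_1)
  then have "\<forall>i. centroid_sqdist T i = power_centroid T"
    unfolding forall_4
    using arith_geo_mean_4(2)[OF _ _ _ _ sum_centroid_sqdist[OF T] _ eq]
    by (simp add: centroid_sqdist_pos[OF T G] less_imp_le)
  then have "centroid T \<bullet> T $ i = (norm (centroid T))\<^sup>2" for i
    using centroid_sqdist_eq[OF T, of i]
    by (simp add: power_centroid_def inner_commute)
  then show False
    using noncoplanar \<open>centroid T \<noteq> 0\<close> unfolding coplanar_iff_in_hyperplane vertices_def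
    by blast
qed

lemma ptolemy_form_scaleR: "ptolemy_form (c *\<^sub>R q) = c\<^sup>2 * ptolemy_form q"
  by (simp add: ptolemy_form_def split_beta power2_eq_square algebra_simps)

lemma noncoplanar_iff_ptolemy_form_pos:
  assumes "on_sphere T"
  shows "\<not> coplanar (vertices T) \<longleftrightarrow> ptolemy_form (opposite_products T) > 0"
  by (simp add: ptolemy_eq_triple_product[OF assms] coplanar_iff_triple_product)

lemma noncoplanar_imp_centroid_in_ball:
  assumes "on_sphere T" and "\<not> coplanar (vertices T)"
  shows "norm (centroid T) < 1"
proof (rule centroid_in_ball[OF assms(1)])
  show "T $ 2 \<noteq> T $ 1"
    using assms(2) by (auto simp: coplanar_iff_triple_product triple_product_def)
qed

section \<open>Convergence of the iteration\<close>

lemma bounded_on_sphere: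
  assumes "on_sphere T"
  shows "T \<in> cball 0 4"
proof -
  have "norm T \<le> (\<Sum>i\<in>UNIV. norm (T $ i))"
    unfolding norm_vec_def by (rule L2_set_le_sum) simp
  then show ?thesis
    using assms by (simp add: on_sphere_def)
qed

locale centroid_iteration =
  fixes T :: "nat \<Rightarrow> quadruple"
  assumes initial_on_sphere: "on_sphere (T 0)"
    and initial_noncoplanar: "\<not> coplanar (vertices (T 0))"
    and step: "T (Suc n) = next_quadruple (T n)"
begin

text \<open>The Ptolemy form is only multiplied by a positive factor in each step, so its positivity,
that is non-coplanarity, is never lost.\<close>

lemma nondegenerate: "on_sphere (T n) \<and> \<not> coplanar (vertices (T n))"
proof (induction n)
  case 0
  show ?case
    using initial_on_sphere initial_noncoplanar by simp
next
  case (Suc n)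
  then have T: "on_sphere (T n)" "\<not> coplanar (vertices (T n))"
    by simp_all
  have G: "norm (centroid (T n)) < 1"
    using noncoplanar_imp_centroid_in_ball[OF T] .
  have next_on: "on_sphere (T (Suc n))"
    unfolding step by (rule on_sphere_next_quadruple[OF T(1) G])
  have "ptolemy_form (opposite_products (T n)) > 0"
    using T noncoplanar_iff_ptolemy_form_pos by blast
  then have "ptolemy_form (opposite_products (T (Suc n))) > 0"
    using scale_factor_ge_1[OF T(1) G]
    by (simp add: step opposite_products_next_quadruple[OF T(1) G] ptolemy_form_scaleR)
  then show ?case
    using next_on noncoplanar_iff_ptolemy_form_pos by blast
qed

lemmas on_sphere = nondegenerate[THEN conjunct1]
lemmas noncoplanar = nondegenerate[THEN conjunct2]
lemmas centroid_inside = noncoplanar_imp_centroid_in_ball[OF on_sphere noncoplanar]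

definition total_scale :: "nat \<Rightarrow> real" where
  "total_scale n = (\<Prod>k<n. scale_factor (T k))"

lemma opposite_products_eq: "opposite_products (T n) = total_scale n *\<^sub>R opposite_products (T 0)"
  by (induction n)
    (simp_all add: total_scale_def step mult.commute
      opposite_products_next_quadruple[OF on_sphere centroid_inside])

lemma scale_ge_1: "scale_factor (T n) \<ge> 1"
  by (rule scale_factor_ge_1[OF on_sphere centroid_inside])

lemma total_scale_ge_1: "total_scale n \<ge> 1"
  unfolding total_scale_def by (rule prod_ge_1) (rule scale_ge_1)

text \<open>If one of the three products were zero, the Ptolemy form would be minus the square of the difference of
the other two.\<close>

lemma initial_product_pos: "sqedge (T 0) 1 2 * sqedge (T 0) 3 4 > 0"
proof (rule ccontr)
  assume "\<not> ?thesis"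
  moreover have "sqedge (T 0) 1 2 * sqedge (T 0) 3 4 \<ge> 0"
    by (simp add: sqedge_def)
  ultimately have "sqedge (T 0) 1 2 * sqedge (T 0) 3 4 = 0"
    by linarith
  moreover have "ptolemy_form (0, y, z) \<le> 0" for y z
    using zero_le_power2[of "y - z"] by (simp add: ptolemy_form_def power2_diff)
  ultimately have "ptolemy_form (opposite_products (T 0)) \<le> 0"
    unfolding opposite_products_def by (simp only:)
  then show False
    using initial_noncoplanar noncoplanar_iff_ptolemy_form_pos[OF initial_on_sphere] by simp
qed

text \<open>The factors are at least \<open>1\<close>, so the total scale increases; it is bounded because edges of a
tetrahedron in the sphere have length at most \<open>2\<close>.\<close>

lemma total_scale_convergent: "convergent total_scale"
proof (rule Bseq_mono_convergent)
  let ?P = "sqedge (T 0) 1 2 * sqedge (T 0) 3 4"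
  have edge: "0 \<le> sqedge (T n) i j \<and> sqedge (T n) i j \<le> 4" for n i j
  proof -
    have "dist (T n $ i) (T n $ j) \<le> 2"
      using on_sphere[of n] norm_triangle_ineq4[of "T n $ i" "T n $ j"]
      by (simp add: on_sphere_def dist_norm)
    then show ?thesis
      using power_mono[of "dist (T n $ i) (T n $ j)" 2 2] by (simp add: sqedge_def)
  qed
  have "total_scale n * ?P \<le> 16" for n
    using opposite_products_eq[of n] mult_mono[of "sqedge (T n) 1 2" 4 "sqedge (T n) 3 4" 4]
      edge[of n] by (simp add: opposite_products_def)
  then have "total_scale n \<le> 16 / ?P" for n
    by (simp only: pos_le_divide_eq[OF initial_product_pos])
  then have "norm (total_scale n) \<le> 16 / ?P" for n
    using order_trans[OF zero_le_one total_scale_ge_1] by (simp only: real_norm_def abs_of_nonneg)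
  then show "Bseq total_scale"
    by (rule BseqI')
  have "total_scale n \<le> total_scale (Suc n)" for n
    using mult_left_mono[OF scale_ge_1[of n], of "total_scale n"] total_scale_ge_1[of n]
    by (simp add: total_scale_def)
  then have "incseq total_scale"
    by (rule incseq_SucI)
  then show "\<forall>m n. m \<le> n \<longrightarrow> total_scale m \<le> total_scale n"
    by (simp add: incseq_def)
qed

definition limit_scale :: real where
  "limit_scale = lim total_scale"

lemma total_scale_limit: "total_scale \<longlonglongrightarrow> limit_scale"
  using total_scale_convergent by (simp add: limit_scale_def convergent_LIMSEQ_iff)

lemma limit_scale_pos: "limit_scale > 0"
  using LIMSEQ_le_const[OF total_scale_limit, of 1] total_scale_ge_1 by force

definition amgm_defect :: "quadruple \<Rightarrow> real" where
  "amgm_defect X = power_centroid X ^ 4 - centroid_sqdist X 1 * centroid_sqdist X 2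
     * centroid_sqdist X 3 * centroid_sqdist X 4"

text \<open>Convergence of the infinite product of scale factors forces them to tend to \<open>1\<close>, so the
mean inequality becomes an equality in the limit. The defect is in fact dominated by the increments
of the total scale.\<close>

lemma amgm_defect_limit: "(\<lambda>n. amgm_defect (T n)) \<longlonglongrightarrow> 0"
proof (rule tendsto_sandwich)
  have "0 \<le> amgm_defect (T n) \<and> amgm_defect (T n) \<le> total_scale (Suc n) - total_scale n" for n
  proof
    let ?R = "centroid_sqdist (T n) 1 * centroid_sqdist (T n) 2
     * centroid_sqdist (T n) 3 * centroid_sqdist (T n) 4"
    let ?l = "scale_factor (T n)"
    have R: "?R > 0" "?R \<le> power_centroid (T n) ^ 4"
      using arith_geo_mean_4(1)[OF _ _ _ _ sum_centroid_sqdist[OF on_sphere]]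
        centroid_sqdist_pos[OF on_sphere centroid_inside] by (simp_all add: less_imp_le)
    then show "0 \<le> amgm_defect (T n)"
      by (simp add: amgm_defect_def)
    have "power_centroid (T n) \<ge> 0" "power_centroid (T n) \<le> 1"
      using centroid_inside[of n] by (simp_all add: power_centroid_def abs_square_le_1)
    then have "?R \<le> 1"
      using R(2) power_le_one order_trans by blast
    have "?l * ?R = power_centroid (T n) ^ 4"
      using R(1)[THEN less_imp_neq, THEN not_sym] scale_factor_def
      by (rule iffD1[OF nonzero_eq_divide_eq])
    then have "amgm_defect (T n) = (?l - 1) * ?R"
      by (simp only: amgm_defect_def left_diff_distrib mult_1)
    \<comment> \<open>The product of the squared distances and the total scale lie on opposite sides of \<open>1\<close>.\<close>
    also have "\<dots> \<le> (?l - 1) * total_scale n"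
      using \<open>?R \<le> 1\<close> total_scale_ge_1[of n] scale_ge_1[of n] by (intro mult_left_mono) auto
    also have "\<dots> = total_scale (Suc n) - total_scale n"
      by (simp add: total_scale_def algebra_simps)
    finally show "amgm_defect (T n) \<le> total_scale (Suc n) - total_scale n" .
  qed
  then show "\<forall>\<^sub>F n in sequentially. 0 \<le> amgm_defect (T n)"
    and "\<forall>\<^sub>F n in sequentially. amgm_defect (T n) \<le> total_scale (Suc n) - total_scale n"
    by simp_all
  show "(\<lambda>n. total_scale (Suc n) - total_scale n) \<longlonglongrightarrow> 0"
    using tendsto_diff[OF LIMSEQ_Suc[OF total_scale_limit] total_scale_limit] by simp
qed simp

lemma cluster_point_on_sphere:
  assumes "cluster_point T X"
  shows "on_sphere X"
proof -
  have "norm (X $ i) = 1" for i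
  proof (rule cluster_point_limit[where \<phi> = "\<lambda>X. norm (X $ i)", OF assms])
    show "continuous_on UNIV (\<lambda>X :: quadruple. norm (X $ i))"
      by (intro continuous_intros)
    show "(\<lambda>n. norm (T n $ i)) \<longlonglongrightarrow> 1"
      using on_sphere by (simp add: on_sphere_def)
  qed
  then show ?thesis
    by (simp add: on_sphere_def)
qed

lemma continuous_on_opposite_products: "continuous_on UNIV opposite_products"
proof -
  have "continuous_on UNIV (\<lambda>T. sqedge T i j)" for i j
    unfolding sqedge_def by (intro continuous_intros)
  then show ?thesis
    unfolding opposite_products_def[abs_def]
    by (intro continuous_on_Pair continuous_on_mult)
qed

lemma opposite_products_limit:
  "(\<lambda>n. opposite_products (T n)) \<longlonglongrightarrow> limit_scale *\<^sub>R opposite_products (T 0)"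
proof -
  have "(\<lambda>n. opposite_products (T n)) = (\<lambda>n. total_scale n *\<^sub>R opposite_products (T 0))"
    by (rule ext) (rule opposite_products_eq)
  then show ?thesis
    by (simp only: tendsto_scaleR[OF total_scale_limit tendsto_const])
qed

lemma cluster_point_opposite_products:
  assumes "cluster_point T X"
  shows "opposite_products X = limit_scale *\<^sub>R opposite_products (T 0)"
  by (rule cluster_point_limit[where \<phi> = opposite_products, OF assms
        continuous_on_opposite_products opposite_products_limit])

text \<open>At a cluster point the Ptolemy form is the initial one times \<open>limit_scale\<^sup>2\<close>, which is positive.
This excludes flat limits such as rectangles, for which the mean inequality is an equality as well.\<close>

lemma cluster_point_noncoplanar:
  assumes "cluster_point T X"
  shows "\<not> coplanar (vertices X)"
  using noncoplanar_iff_ptolemy_form_pos[OF initial_on_sphere] initial_noncoplanar limit_scale_pos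
  by (simp add: noncoplanar_iff_ptolemy_form_pos[OF cluster_point_on_sphere[OF assms]]
      cluster_point_opposite_products[OF assms] ptolemy_form_scaleR)

lemma continuous_on_centroid: "continuous_on UNIV centroid"
  unfolding centroid_def[abs_def] by (intro continuous_intros)

lemma cluster_point_centroid:
  assumes "cluster_point T X"
  shows "centroid X = 0"
proof (rule centroid_eq_0_if_amgm_equality)
  show "on_sphere X" "\<not> coplanar (vertices X)"
    using assms by (rule cluster_point_on_sphere cluster_point_noncoplanar)+
  then show "norm (centroid X) < 1"
    by (rule noncoplanar_imp_centroid_in_ball)
  have "amgm_defect X = 0"
  proof (rule cluster_point_limit[where \<phi> = amgm_defect, OF assms _ amgm_defect_limit])
    show "continuous_on UNIV amgm_defect"
      unfolding amgm_defect_def[abs_def] power_centroid_def centroid_sqdist_def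
      by (intro continuous_intros continuous_on_centroid)
  qed
  then show "centroid_sqdist X 1 * centroid_sqdist X 2 * centroid_sqdist X 3
      * centroid_sqdist X 4 = power_centroid X ^ 4"
    by (simp add: amgm_defect_def)
qed

lemma centroid_tendsto_0: "(\<lambda>n. centroid (T n)) \<longlonglongrightarrow> 0"
  by (rule tendsto_if_cluster_points[where \<phi> = centroid, OF compact_cball bounded_on_sphere[OF on_sphere]
        continuous_on_centroid cluster_point_centroid])

lemma cluster_point_exists: "\<exists>X. cluster_point T X"
  by (rule compact_imp_cluster_point_of_subsequence[where f = T, OF compact_cball
        bounded_on_sphere[OF on_sphere] strict_mono_id]) blast

text \<open>Opposite edges of a cluster point agree, so each squared edge is the square root of a product
of opposite squared edges, that is of \<open>limit_scale\<close> times an initial product. Their sum \<open>8\<close> then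
determines \<open>limit_scale\<close>, which turns out to be \<open>L\<close>.\<close>

lemma cluster_point_edges:
  assumes X: "cluster_point T X"
    and L: "L = 64 / (sqrt (sqedge (T 0) 1 2 * sqedge (T 0) 3 4)
                    + sqrt (sqedge (T 0) 1 3 * sqedge (T 0) 2 4)
                    + sqrt (sqedge (T 0) 1 4 * sqedge (T 0) 2 3))\<^sup>2"
  shows "(sqedge X 1 2)\<^sup>2 = L * (sqedge (T 0) 1 2 * sqedge (T 0) 3 4)"
    and "(sqedge X 1 3)\<^sup>2 = L * (sqedge (T 0) 1 3 * sqedge (T 0) 2 4)"
    and "(sqedge X 1 4)\<^sup>2 = L * (sqedge (T 0) 1 4 * sqedge (T 0) 2 3)"
proof -
  let ?P = "sqedge (T 0) 1 2 * sqedge (T 0) 3 4"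
  let ?Q = "sqedge (T 0) 1 3 * sqedge (T 0) 2 4"
  let ?R = "sqedge (T 0) 1 4 * sqedge (T 0) 2 3"
  define s where "s = sqrt ?P + sqrt ?Q + sqrt ?R"
  note balanced = balanced_edges[OF cluster_point_on_sphere[OF X] cluster_point_centroid[OF X]]
  have sq: "(sqedge X 1 2)\<^sup>2 = limit_scale * ?P" "(sqedge X 1 3)\<^sup>2 = limit_scale * ?Q"
    "(sqedge X 1 4)\<^sup>2 = limit_scale * ?R"
    using cluster_point_opposite_products[OF X] balanced(1-3)
    by (simp_all add: opposite_products_def power2_eq_square)
  have root: "d = sqrt limit_scale * sqrt p" if "d\<^sup>2 = limit_scale * p" "d \<ge> 0" for d p
    using that by (metis real_sqrt_mult real_sqrt_unique)
  have "sqedge X i j \<ge> 0" for i j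
    by (simp add: sqedge_def)
  then have "sqrt limit_scale * s = 8"
    using balanced(4) root[OF sq(1)] root[OF sq(2)] root[OF sq(3)]
    by (simp add: s_def distrib_left)
  then have "(sqrt limit_scale * s)\<^sup>2 = 8\<^sup>2"
    by (rule arg_cong)
  then have scaled: "limit_scale * s\<^sup>2 = 64"
    using limit_scale_pos by (simp add: power_mult_distrib)
  then have "s\<^sup>2 \<noteq> 0"
    by auto
  then have "limit_scale = 64 / s\<^sup>2"
    using scaled by (rule iffD2[OF nonzero_eq_divide_eq])
  then have "limit_scale = L"
    by (simp only: L s_def)
  then show "(sqedge X 1 2)\<^sup>2 = L * ?P" "(sqedge X 1 3)\<^sup>2 = L * ?Q" "(sqedge X 1 4)\<^sup>2 = L * ?R"
    using sq by simp_all
qed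

lemma cluster_points_isometric:
  assumes S: "cluster_point T S" and X: "cluster_point T X"
  shows "isometric S X"
proof (rule isometric_if_gram_eq[OF cluster_point_noncoplanar[OF S]])
  note on = cluster_point_on_sphere[OF S] cluster_point_on_sphere[OF X]
  note balanced = balanced_edges[OF on(1) cluster_point_centroid[OF S]]
    balanced_edges[OF on(2) cluster_point_centroid[OF X]]
  have nonneg: "sqedge Y i j \<ge> 0" for Y i j
    by (simp add: sqedge_def)
  have edges: "sqedge S 1 2 = sqedge X 1 2" "sqedge S 1 3 = sqedge X 1 3"
    "sqedge S 1 4 = sqedge X 1 4"
    using cluster_point_edges[OF S refl] cluster_point_edges[OF X refl] nonneg
    by (metis power2_eq_imp_eq)+
  have sym: "sqedge Y i j = sqedge Y j i" and diag: "sqedge Y i i = 0" for Y i j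
    by (simp_all add: sqedge_def dist_commute)
  have "\<forall>i j. sqedge S i j = sqedge X i j"
    unfolding forall_4
    using edges balanced diag sym[of _ 2 1] sym[of _ 3 1] sym[of _ 4 1] sym[of _ 3 2]
      sym[of _ 4 2] sym[of _ 4 3] by simp
  then show "S $ i \<bullet> S $ j = X $ i \<bullet> X $ j" for i j
    by (simp add: sqedge_on_sphere on)
qed

end

theorem theorem2:
  fixes T :: "nat \<Rightarrow> quadruple" and L :: real
  assumes sphere: "\<forall>i. T 0 $ i \<in> sphere 0 1"
    and noncoplanar: "\<not> coplanar (vertices (T 0))"
    and iteration: "\<forall>n. T (Suc n) = next_quadruple (T n)"
    and L: "L = 64 / (sqrt (sqedge (T 0) 1 2 * sqedge (T 0) 3 4)
                    + sqrt (sqedge (T 0) 1 3 * sqedge (T 0) 2 4)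
                    + sqrt (sqedge (T 0) 1 4 * sqedge (T 0) 2 3))\<^sup>2"
  shows "(\<lambda>n. dist 0 (centroid (T n))) \<longlonglongrightarrow> 0 \<and>
    (\<exists>S. isosceles S \<and>
         (sqedge S 1 2)\<^sup>2 = L * (sqedge (T 0) 1 2 * sqedge (T 0) 3 4) \<and>
         (sqedge S 1 3)\<^sup>2 = L * (sqedge (T 0) 1 3 * sqedge (T 0) 2 4) \<and>
         (sqedge S 1 4)\<^sup>2 = L * (sqedge (T 0) 1 4 * sqedge (T 0) 2 3) \<and>
         (\<forall>X. cluster_point T X \<longrightarrow> \<not> coplanar (vertices X) \<and> isometric S X))"
proof
  interpret centroid_iteration T
    using sphere noncoplanar iteration by unfold_locales (simp_all add: on_sphere_def)
  show "(\<lambda>n. dist 0 (centroid (T n))) \<longlonglongrightarrow> 0"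
    using tendsto_norm[OF centroid_tendsto_0] by simp
  obtain S where S: "cluster_point T S"
    using cluster_point_exists by blast
  have "isosceles S"
    unfolding isosceles_def
    using cluster_point_noncoplanar[OF S]
      balanced_edges[OF cluster_point_on_sphere[OF S] cluster_point_centroid[OF S]] by simp
  then show "\<exists>S. isosceles S \<and>
         (sqedge S 1 2)\<^sup>2 = L * (sqedge (T 0) 1 2 * sqedge (T 0) 3 4) \<and>
         (sqedge S 1 3)\<^sup>2 = L * (sqedge (T 0) 1 3 * sqedge (T 0) 2 4) \<and>
         (sqedge S 1 4)\<^sup>2 = L * (sqedge (T 0) 1 4 * sqedge (T 0) 2 3) \<and>
         (\<forall>X. cluster_point T X \<longrightarrow> \<not> coplanar (vertices X) \<and> isometric S X)"
    using cluster_point_edges[OF S L] cluster_point_noncoplanar cluster_points_isometric[OF S]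
    by blast
qed

end
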